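(* Let $\mathcal{H}$ be a Hopf algebra over $\mathbb{C}[[h]]$ with Hopf dual $\mathcal{H}^*$, and let $\mathcal{A}$ be a right $\mathcal{H}^*$-comodule algebra with coaction $\delta\colon\mathcal{A}\to\mathcal{A}\otimes\mathcal{H}^*$. Any character $\chi$ of $\mathcal{A}$ defines an algebra homomorphism $$\varphi_\chi=(\chi\otimes\mathrm{id})\circ\delta\colon\ \mathcal{A}\to\mathbb{C}[[h]]\otimes\mathcal{H}^*\simeq\mathcal{H}^*$$ fulfilling the equivariance condition $$(\varphi_\chi\otimes\mathrm{id})\circ\delta=\Delta\circ\varphi_\chi ,$$ where $\Delta$ is the coproduct of $\mathcal{H}^*$. Conversely, any algebra homomorphism $\varphi\colon\mathcal{A}\to\mathcal{H}^*$ satisfying $(\varphi\otimes\mathrm{id})\circ\delta=\Delta\circ\varphi$ has the form $\varphi=\varphi_\chi$ for some character $\chi$ of $\mathcal{A}$.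
   Context: All algebras are associative unital over $\mathbb{C}[[h]]$ (tensor products completed in the $h$-adic topology). A character of an algebra $\mathcal{A}$ over $\mathbb{C}[[h]]$ is an algebra homomorphism $\mathcal{A}\to\mathbb{C}[[h]]$. A right $\mathcal{H}^*$-comodule algebra is an associative algebra $\mathcal{A}$ with an algebra homomorphism $\delta\colon\mathcal{A}\to\mathcal{A}\otimes\mathcal{H}^*$ such that $(\mathrm{id}\otimes\Delta)\circ\delta=(\delta\otimes\mathrm{id})\circ\delta$, $\delta(1)=1\otimes1$ and $(\mathrm{id}\otimes\varepsilon)\circ\delta=\mathrm{id}$, where $\varepsilon$ is the counit of $\mathcal{H}^*$ and $\mathcal{A}\otimes\mathbb{C}[[h]]\simeq\mathcal{A}$. *)

theory Defs
  imports "HOL-Computational_Algebra.Formal_Power_Series" "HOL-Library.Poly_Mapping"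
begin

section \<open>Modules and algebras over the ring of formal power series\<close>

text \<open>
  The ground ring \<open>\<complex>[[h]]\<close> is the type \<^typ>\<open>complex fps\<close>, with \<open>h\<close> the series \<^term>\<open>fps_X\<close>.
\<close>

class hmodule = ab_group_add +
  fixes hscale :: "complex fps \<Rightarrow> 'a \<Rightarrow> 'a"  (infixr \<open>*\<^sub>h\<close> 75)
  assumes hscale_right_distrib: "r *\<^sub>h (x + y) = r *\<^sub>h x + r *\<^sub>h y"
    and hscale_left_distrib: "(r + s) *\<^sub>h x = r *\<^sub>h x + s *\<^sub>h x"
    and hscale_hscale: "r *\<^sub>h s *\<^sub>h x = (r * s) *\<^sub>h x"
    and hscale_one: "1 *\<^sub>h x = x"

interpretation hmod: module "hscale :: complex fps \<Rightarrow> 'a::hmodule \<Rightarrow> 'a"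
  by standard (simp_all add: hscale_right_distrib hscale_left_distrib hscale_hscale hscale_one)

abbreviation hlinear :: "('a::hmodule \<Rightarrow> 'b::hmodule) \<Rightarrow> bool"
  where "hlinear \<equiv> module_hom hscale hscale"

definition (in hmodule) hpow :: "nat \<Rightarrow> 'a set"
  where "hpow n = range (\<lambda>x. fps_X ^ n *\<^sub>h x)"

text \<open>
  Modules that are complete and Hausdorff in the \<open>h\<close>-adic topology, whose basic neighbourhoods
  of \<open>0\<close> are the submodules \<open>h\<^sup>n M\<close>. Every Cauchy sequence has a subsequence satisfying the
  premise of \<open>hadic_complete\<close>.
\<close>

class hadic_module = hmodule +
  assumes hadic_separated: "(\<And>n. x \<in> hpow n) \<Longrightarrow> x = 0"
    and hadic_complete: "(\<And>n. s (Suc n) - s n \<in> hpow n) \<Longrightarrow> \<exists>l. \<forall>n. l - s n \<in> hpow n"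

text \<open>
  The class \<^class>\<open>ring_1\<close> is avoided because it excludes the zero algebra.
\<close>

class halgebra = hmodule + ring + monoid_mult +
  assumes hscale_mult_left: "(r *\<^sub>h x) * y = r *\<^sub>h (x * y)"
    and hscale_mult_right: "x * (r *\<^sub>h y) = r *\<^sub>h (x * y)"

class hadic_algebra = halgebra + hadic_module

definition halg_hom :: "('a::halgebra \<Rightarrow> 'b::halgebra) \<Rightarrow> bool"
  where "halg_hom f \<longleftrightarrow> hlinear f \<and> (\<forall>x y. f (x * y) = f x * f y) \<and> f 1 = 1"

lemma hpow_iff: "x \<in> hpow n \<longleftrightarrow> (\<exists>y. x = fps_X ^ n *\<^sub>h y)"
  by (auto simp: hpow_def)

lemma hpowI: "fps_X ^ n *\<^sub>h y \<in> hpow n"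
  by (auto simp: hpow_def)

lemma hpow_0 [simp]: "x \<in> hpow 0"
  by (simp add: hpow_iff)

lemma hpow_zero [simp]: "0 \<in> hpow n"
  using hpowI[of n 0] by simp

lemma hpow_add: "x \<in> hpow n \<Longrightarrow> y \<in> hpow n \<Longrightarrow> x + y \<in> hpow n"
  unfolding hpow_iff by (metis hscale_right_distrib)

lemma hpow_scale: "x \<in> hpow n \<Longrightarrow> r *\<^sub>h x \<in> hpow n"
  unfolding hpow_iff by (metis hmod.scale_left_commute)

lemma hpow_minus: "x \<in> hpow n \<Longrightarrow> - x \<in> hpow n"
  unfolding hpow_iff by (metis hmod.scale_minus_right)

lemma hpow_minus_iff: "- x \<in> hpow n \<longleftrightarrow> x \<in> hpow n"
  using hpow_minus by fastforce

lemma hpow_diff: "x \<in> hpow n \<Longrightarrow> y \<in> hpow n \<Longrightarrow> x - y \<in> hpow n"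
  using hpow_add[OF _ hpow_minus, of x n y] by simp

lemma hpow_diff_commute: "x - y \<in> hpow n \<longleftrightarrow> y - x \<in> hpow n"
  using hpow_minus by fastforce

lemma hpow_diff_trans: "x - y \<in> hpow n \<Longrightarrow> y - z \<in> hpow n \<Longrightarrow> x - z \<in> hpow n"
  using hpow_add[of "x - y" n "y - z"] by simp

lemma hpow_sum: "(\<And>i. i \<in> I \<Longrightarrow> f i \<in> hpow n) \<Longrightarrow> sum f I \<in> hpow n"
  by (induction I rule: infinite_finite_induct) (auto intro: hpow_add)

lemma hpow_mono: "m \<le> n \<Longrightarrow> x \<in> hpow n \<Longrightarrow> x \<in> hpow m"
  unfolding hpow_iff by (metis hscale_hscale le_add_diff_inverse power_add)

lemma hpow_scale_power: "m \<le> n \<Longrightarrow> fps_X ^ n *\<^sub>h x \<in> hpow m"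
  using hpow_mono hpowI by blast

lemma hpow_mult_left: "x \<in> hpow n \<Longrightarrow> x * y \<in> hpow n" for x :: "'a::halgebra"
  unfolding hpow_iff by (metis hscale_mult_left)

lemma hpow_mult_right: "y \<in> hpow n \<Longrightarrow> x * y \<in> hpow n" for x :: "'a::halgebra"
  unfolding hpow_iff by (metis hscale_mult_right)

lemma hpow_cong_add: "a - c \<in> hpow n \<Longrightarrow> b - d \<in> hpow n \<Longrightarrow> a + b - (c + d) \<in> hpow n"
  unfolding add_diff_add by (rule hpow_add)

lemma hpow_cong_diff: "a - c \<in> hpow n \<Longrightarrow> b - d \<in> hpow n \<Longrightarrow> a - b - (c - d) \<in> hpow n"
  using hpow_diff[of "a - c" n "b - d"] by (simp add: algebra_simps)

lemma hpow_cong_minus: "a - c \<in> hpow n \<Longrightarrow> - a - - c \<in> hpow n"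
  using hpow_minus[of "a - c" n] by simp

lemma hpow_cong_scale: "a - c \<in> hpow n \<Longrightarrow> r *\<^sub>h a - r *\<^sub>h c \<in> hpow n"
  using hpow_scale[of "a - c" n r] by (simp add: hmod.scale_right_diff_distrib)

lemma hpow_cong_mult: "a - c \<in> hpow n \<Longrightarrow> b - d \<in> hpow n \<Longrightarrow> a * b - c * d \<in> hpow n"
  for a :: "'a::halgebra"
  using hpow_add[OF hpow_mult_left[of "a - c" n b] hpow_mult_right[of "b - d" n c]]
  by (simp add: algebra_simps)

lemma hlinear_iff:
  "hlinear f \<longleftrightarrow> (\<forall>x y. f (x + y) = f x + f y) \<and> (\<forall>r x. f (r *\<^sub>h x) = r *\<^sub>h f x)"
  by (auto simp: module_hom_def module_hom_axioms_def hmod.module_axioms)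

lemma hlinear_add: "hlinear f \<Longrightarrow> f (x + y) = f x + f y"
  and hlinear_scale: "hlinear f \<Longrightarrow> f (r *\<^sub>h x) = r *\<^sub>h f x"
  by (auto simp: hlinear_iff)

lemma hlinear_diff: "hlinear f \<Longrightarrow> f (x - y) = f x - f y"
  by (rule module_hom.diff)

lemma hlinear_zero: "hlinear f \<Longrightarrow> f 0 = 0"
  by (rule module_hom.zero)

lemma hlinear_hpow: "hlinear f \<Longrightarrow> x \<in> hpow n \<Longrightarrow> f x \<in> hpow n"
  unfolding hpow_iff by (metis hlinear_scale)

lemma hadic_eqI: "(\<And>n. x - y \<in> hpow n) \<Longrightarrow> x = y" for x :: "'a::hadic_module"
  using hadic_separated[of "x - y"] by simp

text \<open>
  A type class instance for \<^typ>\<open>complex fps\<close> has to be stated for \<^typ>\<open>'a fps\<close>, so the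
  coefficients range over commutative \<open>\<complex>\<close>-algebras; on \<^typ>\<open>complex fps\<close> itself, scaling is
  multiplication (lemma \<open>hscale_fps\<close>).
\<close>

unbundle fps_syntax

class comm_complex_algebra = comm_ring_1 +
  fixes of_cplx :: "complex \<Rightarrow> 'a"
  assumes of_cplx_add: "of_cplx (a + b) = of_cplx a + of_cplx b"
    and of_cplx_mult: "of_cplx (a * b) = of_cplx a * of_cplx b"
    and of_cplx_1: "of_cplx 1 = 1"

instantiation complex :: comm_complex_algebra
begin

definition of_cplx_complex :: "complex \<Rightarrow> complex"
  where "of_cplx_complex a = a"

instance
  by standard (simp_all add: of_cplx_complex_def)

end

lemma of_cplx_0: "of_cplx 0 = 0"
  using of_cplx_add[of 0 0] by simp

lemma of_cplx_sum: "of_cplx (sum f I) = (\<Sum>i\<in>I. of_cplx (f i))"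
  by (induction I rule: infinite_finite_induct) (simp_all add: of_cplx_0 of_cplx_add)

instantiation fps :: (comm_complex_algebra) halgebra
begin

definition hscale_fps_def: "r *\<^sub>h f = Abs_fps (\<lambda>n. of_cplx (r $ n)) * f"

instance
proof
  fix r s :: "complex fps" and x y :: "'a fps"
  have add: "Abs_fps (\<lambda>n. of_cplx ((r + s) $ n)) = Abs_fps (\<lambda>n. of_cplx (r $ n) :: 'a) + Abs_fps (\<lambda>n. of_cplx (s $ n))"
    by (rule fps_ext) (simp add: of_cplx_add)
  have mult: "Abs_fps (\<lambda>n. of_cplx ((r * s) $ n)) = Abs_fps (\<lambda>n. of_cplx (r $ n) :: 'a) * Abs_fps (\<lambda>n. of_cplx (s $ n))"
    by (rule fps_ext) (simp add: fps_mult_nth of_cplx_sum of_cplx_mult)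
  have one: "Abs_fps (\<lambda>n. of_cplx ((1 :: complex fps) $ n)) = (1 :: 'a fps)"
    by (rule fps_ext) (simp add: of_cplx_0 of_cplx_1)
  show "r *\<^sub>h (x + y) = r *\<^sub>h x + r *\<^sub>h y"
    by (simp add: hscale_fps_def algebra_simps)
  show "(r + s) *\<^sub>h x = r *\<^sub>h x + s *\<^sub>h x"
    unfolding hscale_fps_def add by (simp add: algebra_simps)
  show "r *\<^sub>h s *\<^sub>h x = (r * s) *\<^sub>h x"
    unfolding hscale_fps_def mult by (simp add: algebra_simps)
  show "1 *\<^sub>h x = x"
    unfolding hscale_fps_def one by simp
  show "(r *\<^sub>h x) * y = r *\<^sub>h (x * y)" "x * (r *\<^sub>h y) = r *\<^sub>h (x * y)"
    by (simp_all add: hscale_fps_def algebra_simps)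
qed

end

lemma fps_X_power_hscale: "fps_X ^ n *\<^sub>h f = fps_X ^ n * f" for f :: "'a::comm_complex_algebra fps"
proof -
  have "Abs_fps (\<lambda>k. of_cplx ((fps_X ^ n :: complex fps) $ k)) = (fps_X ^ n :: 'a fps)"
    by (rule fps_ext) (simp add: fps_X_power_nth of_cplx_0 of_cplx_1)
  then show ?thesis by (simp add: hscale_fps_def)
qed

instance fps :: (comm_complex_algebra) hadic_algebra
proof
  fix x :: "'a fps"
  assume *: "x \<in> hpow n" for n
  show "x = 0"
  proof (rule fps_ext)
    fix k
    from * [of "Suc k"] obtain y where "x = fps_X ^ Suc k *\<^sub>h y"
      by (auto simp: hpow_def)
    then show "x $ k = 0 $ k"
      by (simp only: fps_X_power_hscale fps_X_power_mult_nth) simp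
  qed
next
  fix s :: "nat \<Rightarrow> 'a fps"
  assume *: "s (Suc n) - s n \<in> hpow n" for n
  have step: "s (Suc n) $ k = s n $ k" if "k < n" for n k
  proof -
    from * [of n] obtain y where "s (Suc n) - s n = fps_X ^ n *\<^sub>h y"
      by (auto simp: hpow_def)
    then have "s (Suc n) $ k - s n $ k = (fps_X ^ n * y) $ k"
      by (metis fps_X_power_hscale fps_sub_nth)
    with that show ?thesis by (simp add: fps_X_power_mult_nth)
  qed
  have const: "s n $ k = s (Suc k) $ k" if "Suc k \<le> n" for n k
    using that by (induction n rule: dec_induct) (auto simp: step)
  define l where "l = Abs_fps (\<lambda>k. s (Suc k) $ k)"
  have "l - s n \<in> hpow n" for n
  proof -
    have "l $ k = s n $ k" if "k < n" for k
      using const[of k n] that by (simp add: l_def)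
    then have "l - s n = fps_X ^ n * fps_shift n (l - s n)"
      by (intro fps_ext) (auto simp: fps_X_power_mult_nth)
    then show ?thesis by (metis fps_X_power_hscale hpowI)
  qed
  then show "\<exists>l. \<forall>n. l - s n \<in> hpow n" by blast
qed

lemma hscale_fps: "r *\<^sub>h f = r * f" for f :: "complex fps"
  by (simp add: hscale_fps_def of_cplx_complex_def fps_nth_inverse)


section \<open>Algebraic tensor products\<close>

text \<open>
  The tensor product over \<open>\<complex>[[h]]\<close> is the quotient of the free abelian group on pairs by the
  subgroup generated by the biadditivity and balancing relations.
\<close>

inductive_set tensor_null :: "('a::hmodule \<times> 'b::hmodule \<Rightarrow>\<^sub>0 int) set"
  where
    zero: "0 \<in> tensor_null"
  | diff: "p \<in> tensor_null \<Longrightarrow> q \<in> tensor_null \<Longrightarrow> p - q \<in> tensor_null"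
  | add_left: "frag_of (a + a', b) - frag_of (a, b) - frag_of (a', b) \<in> tensor_null"
  | add_right: "frag_of (a, b + b') - frag_of (a, b) - frag_of (a, b') \<in> tensor_null"
  | balanced: "frag_of (r *\<^sub>h a, b) - frag_of (a, r *\<^sub>h b) \<in> tensor_null"

definition tensor_rel :: "('a::hmodule \<times> 'b::hmodule \<Rightarrow>\<^sub>0 int) \<Rightarrow> ('a \<times> 'b \<Rightarrow>\<^sub>0 int) \<Rightarrow> bool"
  where "tensor_rel p q \<longleftrightarrow> p - q \<in> tensor_null"

lemma tensor_null_minus: "p \<in> tensor_null \<Longrightarrow> - p \<in> tensor_null"
  using tensor_null.diff[OF tensor_null.zero, of p] by simp

lemma tensor_null_add: "p \<in> tensor_null \<Longrightarrow> q \<in> tensor_null \<Longrightarrow> p + q \<in> tensor_null"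
  using tensor_null.diff[OF _ tensor_null_minus, of p q] by simp

quotient_type (overloaded) ('a, 'b) tensor = "'a::hmodule \<times> 'b::hmodule \<Rightarrow>\<^sub>0 int" / tensor_rel
proof (rule equivpI)
  show "reflp (tensor_rel :: ('a \<times> 'b \<Rightarrow>\<^sub>0 int) \<Rightarrow> _)"
    by (auto simp: reflp_def tensor_rel_def intro: tensor_null.zero)
  show "symp (tensor_rel :: ('a \<times> 'b \<Rightarrow>\<^sub>0 int) \<Rightarrow> _)"
    by (auto simp: symp_def tensor_rel_def dest: tensor_null_minus)
  show "transp (tensor_rel :: ('a \<times> 'b \<Rightarrow>\<^sub>0 int) \<Rightarrow> _)"
    unfolding transp_def tensor_rel_def using tensor_null_add by fastforce
qed

lift_definition pure :: "'a::hmodule \<Rightarrow> 'b::hmodule \<Rightarrow> ('a, 'b) tensor"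
  is "\<lambda>a b. frag_of (a, b)" .

lemma tensor_null_extend:
  "p \<in> tensor_null \<Longrightarrow> frag_extend (\<lambda>(a, b). frag_of (r *\<^sub>h a, b)) p \<in> tensor_null"
proof (induction rule: tensor_null.induct)
  case (add_left a a' b)
  then show ?case
    by (simp add: frag_extend_diff hscale_right_distrib tensor_null.add_left)
next
  case (add_right a b b')
  then show ?case
    by (simp add: frag_extend_diff tensor_null.add_right)
next
  case (balanced s a b)
  then show ?case
    using tensor_null.balanced[of s "r *\<^sub>h a" b] by (simp add: frag_extend_diff mult.commute)
qed (auto simp: frag_extend_diff intro: tensor_null.intros)

instantiation tensor :: (hmodule, hmodule) hmodule
begin

lift_definition zero_tensor :: "('a, 'b) tensor" is 0 .

lift_definition plus_tensor :: "('a, 'b) tensor \<Rightarrow> ('a, 'b) tensor \<Rightarrow> ('a, 'b) tensor"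
  is "(+)"
  by (simp add: tensor_rel_def add_diff_add tensor_null_add)

lift_definition uminus_tensor :: "('a, 'b) tensor \<Rightarrow> ('a, 'b) tensor"
  is "uminus"
  unfolding tensor_rel_def using tensor_null_minus by fastforce

lift_definition minus_tensor :: "('a, 'b) tensor \<Rightarrow> ('a, 'b) tensor \<Rightarrow> ('a, 'b) tensor"
  is "(-)"
proof -
  fix p p' q q' :: "'a \<times> 'b \<Rightarrow>\<^sub>0 int"
  assume "tensor_rel p p'" "tensor_rel q q'"
  then have "(p - p') - (q - q') \<in> tensor_null" by (auto simp: tensor_rel_def intro: tensor_null.diff)
  moreover have "(p - p') - (q - q') = (p - q) - (p' - q')" by simp
  ultimately show "tensor_rel (p - q) (p' - q')" by (simp add: tensor_rel_def)
qed

lift_definition hscale_tensor :: "complex fps \<Rightarrow> ('a, 'b) tensor \<Rightarrow> ('a, 'b) tensor"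
  is "\<lambda>r. frag_extend (\<lambda>(a, b). frag_of (r *\<^sub>h a, b))"
  unfolding tensor_rel_def by (metis tensor_null_extend frag_extend_diff)

instance
proof
  fix r s :: "complex fps" and x y z :: "('a, 'b) tensor"
  show "x + y + z = x + (y + z)"
    by transfer (simp add: tensor_rel_def tensor_null.zero add.assoc)
  show "x + y = y + x"
    by transfer (simp add: tensor_rel_def tensor_null.zero add.commute)
  show "0 + x = x" "- x + x = 0" "x - y = x + - y"
    by (transfer; simp add: tensor_rel_def tensor_null.zero)+
  show "r *\<^sub>h (x + y) = r *\<^sub>h x + r *\<^sub>h y"
    by transfer (simp add: tensor_rel_def tensor_null.zero frag_extend_add)
  show "(r + s) *\<^sub>h x = r *\<^sub>h x + s *\<^sub>h x"
  proof transfer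
    fix r s :: "complex fps" and p :: "'a \<times> 'b \<Rightarrow>\<^sub>0 int"
    have "frag_extend (\<lambda>(a, b). frag_of ((r + s) *\<^sub>h a, b)) p
      - frag_extend (\<lambda>(a, b). frag_of (r *\<^sub>h a, b)) p
      - frag_extend (\<lambda>(a, b). frag_of (s *\<^sub>h a, b)) p \<in> tensor_null" (is "?f p \<in> _")
    proof (induction p rule: frag_induction[OF subset_UNIV])
      case (2 x)
      then show ?case by (cases x) (simp add: hscale_left_distrib tensor_null.add_left)
    next
      case (3 p q)
      have "?f (p - q) = ?f p - ?f q" by (simp add: frag_extend_diff)
      with 3 show ?case by (metis tensor_null.diff)
    qed (simp_all add: tensor_null.zero)
    then show "tensor_rel (frag_extend (\<lambda>(a, b). frag_of ((r + s) *\<^sub>h a, b)) p)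
      (frag_extend (\<lambda>(a, b). frag_of (r *\<^sub>h a, b)) p + frag_extend (\<lambda>(a, b). frag_of (s *\<^sub>h a, b)) p)"
      by (simp add: tensor_rel_def diff_diff_add)
  qed
  have comp: "frag_extend (\<lambda>(a, b). frag_of (r *\<^sub>h a, b)) (frag_extend (\<lambda>(a, b). frag_of (s *\<^sub>h a, b)) p)
      = frag_extend (\<lambda>(a, b). frag_of ((r * s) *\<^sub>h a, b)) p" for r s and p :: "'a \<times> 'b \<Rightarrow>\<^sub>0 int"
    by (induction p rule: frag_induction[OF subset_UNIV]) (auto simp: frag_extend_diff hscale_hscale)
  show "r *\<^sub>h s *\<^sub>h x = (r * s) *\<^sub>h x"
    by transfer (simp add: tensor_rel_def tensor_null.zero comp)
  have one: "frag_extend (\<lambda>(a, b). frag_of (1 *\<^sub>h a, b)) p = p" for p :: "'a \<times> 'b \<Rightarrow>\<^sub>0 int"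
    by (induction p rule: frag_induction[OF subset_UNIV]) (auto simp: frag_extend_diff hscale_one)
  show "1 *\<^sub>h x = x"
    by transfer (simp add: tensor_rel_def tensor_null.zero one[unfolded hscale_one] hscale_one)
qed

end

lemma pure_add_left: "pure (a + a') b = pure a b + pure a' b"
  by transfer (metis tensor_rel_def tensor_null.add_left diff_diff_eq)

lemma pure_add_right: "pure a (b + b') = pure a b + pure a b'"
  by transfer (metis tensor_rel_def tensor_null.add_right diff_diff_eq)

lemma pure_scale_left: "pure (r *\<^sub>h a) b = r *\<^sub>h pure a b"
  by transfer (simp add: tensor_rel_def tensor_null.zero)

lemma pure_scale_right: "pure a (r *\<^sub>h b) = r *\<^sub>h pure a b"
proof -
  have "pure a (r *\<^sub>h b) = pure (r *\<^sub>h a) b"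
    by transfer (metis tensor_rel_def tensor_null.balanced tensor_null_minus minus_diff_eq)
  then show ?thesis by (simp add: pure_scale_left)
qed

definition hbilinear :: "('a::hmodule \<Rightarrow> 'b::hmodule \<Rightarrow> 'c::hmodule) \<Rightarrow> bool"
  where "hbilinear \<beta> \<longleftrightarrow> (\<forall>b. hlinear (\<lambda>a. \<beta> a b)) \<and> (\<forall>a. hlinear (\<beta> a))"

lemma tensor_induct [case_names pure diff]:
  assumes "\<And>a b. P (pure a b)" "\<And>s t. P s \<Longrightarrow> P t \<Longrightarrow> P (s - t)"
  shows "P t"
proof -
  have zero: "P 0" using assms(2)[OF assms(1) assms(1), of 0 0 0 0] by simp
  have "P (abs_tensor p)" for p :: "'a \<times> 'b \<Rightarrow>\<^sub>0 int"
  proof (induction p rule: frag_induction[OF subset_UNIV])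
    case 1
    then show ?case using zero by (simp add: zero_tensor_def)
  next
    case (2 x)
    then show ?case using assms(1) by (cases x) (simp add: pure.abs_eq)
  next
    case (3 p q)
    then show ?case using assms(2)[of "abs_tensor p" "abs_tensor q"] by (simp add: minus_tensor.abs_eq)
  qed
  from this[of "rep_tensor t"] show ?thesis by (simp add: Quotient3_abs_rep[OF Quotient3_tensor])
qed

lemma hlinear_tensor_eqI:
  assumes "hlinear F" "hlinear G" "\<And>a b. F (pure a b) = G (pure a b)"
  shows "F t = G t"
  by (induction t rule: tensor_induct) (use assms in \<open>simp_all add: hlinear_diff\<close>)

definition free_extend :: "('k \<Rightarrow> 'c::hmodule) \<Rightarrow> ('k \<Rightarrow>\<^sub>0 int) \<Rightarrow> 'c"
  where "free_extend f p = (\<Sum>k\<in>Poly_Mapping.keys p. of_int (Poly_Mapping.lookup p k) *\<^sub>h f k)"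

lemma free_extend_superset:
  assumes "finite K" "Poly_Mapping.keys p \<subseteq> K"
  shows "free_extend f p = (\<Sum>k\<in>K. of_int (Poly_Mapping.lookup p k) *\<^sub>h f k)"
  unfolding free_extend_def
  by (rule sum.mono_neutral_left) (use assms in \<open>auto simp: in_keys_iff\<close>)

lemma free_extend_zero: "free_extend f 0 = 0"
  by (simp add: free_extend_def)

lemma free_extend_diff: "free_extend f (p - q) = free_extend f p - free_extend f q"
proof -
  let ?K = "Poly_Mapping.keys p \<union> Poly_Mapping.keys q"
  have "Poly_Mapping.keys (p - q) \<subseteq> ?K" by (auto simp: in_keys_iff lookup_minus)
  then show ?thesis
    by (simp add: free_extend_superset[of ?K] lookup_minus hmod.scale_left_diff_distrib sum_subtractf)
qed

lemma free_extend_of: "free_extend f (frag_of k) = f k"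
  by (simp add: free_extend_def hscale_one)

lemma hbilinear_simps:
  assumes "hbilinear \<beta>"
  shows "\<beta> (a + a') b = \<beta> a b + \<beta> a' b" "\<beta> a (b + b') = \<beta> a b + \<beta> a b'"
    "\<beta> (r *\<^sub>h a) b = r *\<^sub>h \<beta> a b" "\<beta> a (r *\<^sub>h b) = r *\<^sub>h \<beta> a b"
  using assms by (auto simp: hbilinear_def hlinear_iff)

lemma tensor_lift_exists:
  assumes "hbilinear \<beta>"
  shows "\<exists>F. hlinear F \<and> (\<forall>a b. F (pure a b) = \<beta> a b)"
proof -
  let ?e = "free_extend (\<lambda>(a, b). \<beta> a b)"
  have null: "p \<in> tensor_null \<Longrightarrow> ?e p = 0" for p
    by (induction rule: tensor_null.induct)
      (simp_all add: free_extend_zero free_extend_diff free_extend_of hbilinear_simps[OF assms])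
  define F where "F t = ?e (rep_tensor t)" for t
  have F_abs: "F (abs_tensor p) = ?e p" for p
  proof -
    have "tensor_rel (rep_tensor (abs_tensor p)) p"
      by (simp add: Quotient3_abs_rep[OF Quotient3_tensor] flip: tensor.abs_eq_iff)
    then have "?e (rep_tensor (abs_tensor p) - p) = 0" by (simp add: tensor_rel_def null)
    then show ?thesis by (simp add: F_def free_extend_diff)
  qed
  have pure: "F (pure a b) = \<beta> a b" for a b
    by (simp add: pure.abs_eq F_abs free_extend_of)
  have diff: "F (s - t) = F s - F t" for s t
  proof -
    have "s - t = abs_tensor (rep_tensor s - rep_tensor t)"
      by (simp add: Quotient3_abs_rep[OF Quotient3_tensor] flip: minus_tensor.abs_eq)
    then show ?thesis by (simp add: F_abs free_extend_diff) (simp add: F_def)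
  qed
  have zero: "F 0 = 0" using diff[of 0 0] by simp
  have add: "F (s + t) = F s + F t" for s t
    using diff[of s "- t"] diff[of 0 t] zero by simp
  have "F (r *\<^sub>h t) = r *\<^sub>h F t" for r t
    by (induction t rule: tensor_induct)
      (simp_all add: pure diff hmod.scale_right_diff_distrib hbilinear_simps[OF assms] flip: pure_scale_left)
  with add pure show ?thesis by (auto simp: hlinear_iff)
qed

definition tensor_lift :: "('a::hmodule \<Rightarrow> 'b::hmodule \<Rightarrow> 'c::hmodule) \<Rightarrow> ('a, 'b) tensor \<Rightarrow> 'c"
  where "tensor_lift \<beta> = (THE F. hlinear F \<and> (\<forall>a b. F (pure a b) = \<beta> a b))"

lemma tensor_lift:
  assumes "hbilinear \<beta>"
  shows hlinear_tensor_lift: "hlinear (tensor_lift \<beta>)"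
    and tensor_lift_pure: "tensor_lift \<beta> (pure a b) = \<beta> a b"
proof -
  have "\<exists>!F. hlinear F \<and> (\<forall>a b. F (pure a b) = \<beta> a b)"
  proof (rule ex_ex1I[OF tensor_lift_exists[OF assms]])
    fix F G :: "('a, 'b) tensor \<Rightarrow> 'c"
    assume "hlinear F \<and> (\<forall>a b. F (pure a b) = \<beta> a b)" "hlinear G \<and> (\<forall>a b. G (pure a b) = \<beta> a b)"
    then show "F = G" by - (rule ext, rule hlinear_tensor_eqI, simp_all)
  qed
  from theI'[OF this] show "hlinear (tensor_lift \<beta>)" "tensor_lift \<beta> (pure a b) = \<beta> a b"
    by (auto simp: tensor_lift_def)
qed

lemma hbilinearI:
  assumes "\<And>a a' b. \<beta> (a + a') b = \<beta> a b + \<beta> a' b" "\<And>a b b'. \<beta> a (b + b') = \<beta> a b + \<beta> a b'"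
    "\<And>r a b. \<beta> (r *\<^sub>h a) b = r *\<^sub>h \<beta> a b" "\<And>r a b. \<beta> a (r *\<^sub>h b) = r *\<^sub>h \<beta> a b"
  shows "hbilinear \<beta>"
  using assms by (auto simp: hbilinear_def hlinear_iff)

lemma hlinear_id: "hlinear (\<lambda>x. x)"
  by (simp add: hlinear_iff)

lemma hlinear_compose: "hlinear f \<Longrightarrow> hlinear g \<Longrightarrow> hlinear (\<lambda>x. g (f x))"
  by (simp add: hlinear_iff)

lemma hlinear_plus: "hlinear f \<Longrightarrow> hlinear g \<Longrightarrow> hlinear (\<lambda>x. f x + g x)"
  by (simp add: hlinear_iff hscale_right_distrib algebra_simps)

lemma hlinear_scaled: "hlinear f \<Longrightarrow> hlinear (\<lambda>x. r *\<^sub>h f x)"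
  by (simp add: hlinear_iff hscale_right_distrib mult.commute)

lemma hbilinear_pure_mult: "hbilinear (\<lambda>c d. pure (a * c) (b * d))"
  for a :: "'a::halgebra" and b :: "'b::halgebra"
  by (rule hbilinearI)
    (simp_all add: distrib_left pure_add_left pure_add_right hscale_mult_right pure_scale_left pure_scale_right)

lemma hbilinear_mult_aux:
  "hbilinear (\<lambda>a b. tensor_lift (\<lambda>c d. pure (a * c) (b * d)) y)"
  for y :: "('a::halgebra, 'b::halgebra) tensor"
proof -
  define L where "L a b = tensor_lift (\<lambda>c d. pure (a * c) (b * d))" for a :: 'a and b :: 'b
  have lin: "hlinear (L a b)" for a b
    unfolding L_def by (rule hlinear_tensor_lift[OF hbilinear_pure_mult])
  have [simp]: "L a b (pure c d) = pure (a * c) (b * d)" for a b c d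
    unfolding L_def by (rule tensor_lift_pure[OF hbilinear_pure_mult])
  note [simp] = distrib_right pure_add_left pure_add_right
    hscale_mult_left pure_scale_left pure_scale_right
  have "hbilinear (\<lambda>a b. L a b y)"
  proof (rule hbilinearI)
    fix a a' :: 'a and b b' :: 'b and r
    show "L (a + a') b y = L a b y + L a' b y"
      by (rule hlinear_tensor_eqI[OF lin hlinear_plus[OF lin lin]]) simp
    show "L a (b + b') y = L a b y + L a b' y"
      by (rule hlinear_tensor_eqI[OF lin hlinear_plus[OF lin lin]]) simp
    show "L (r *\<^sub>h a) b y = r *\<^sub>h L a b y"
      by (rule hlinear_tensor_eqI[OF lin hlinear_scaled[OF lin]]) simp
    show "L a (r *\<^sub>h b) y = r *\<^sub>h L a b y"
      by (rule hlinear_tensor_eqI[OF lin hlinear_scaled[OF lin]]) simp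
  qed
  then show ?thesis by (simp add: L_def)
qed

instantiation tensor :: (halgebra, halgebra) halgebra
begin

definition times_tensor :: "('a, 'b) tensor \<Rightarrow> ('a, 'b) tensor \<Rightarrow> ('a, 'b) tensor"
  where "x * y = tensor_lift (\<lambda>a b. tensor_lift (\<lambda>c d. pure (a * c) (b * d)) y) x"

definition one_tensor :: "('a, 'b) tensor"
  where "1 = pure 1 1"

lemma pure_mult_pure: "pure a b * pure c d = pure (a * c) (b * d)"
  unfolding times_tensor_def
  by (subst tensor_lift_pure[OF hbilinear_mult_aux]) (rule tensor_lift_pure[OF hbilinear_pure_mult])

lemma hlinear_mult_tensor: "hlinear (\<lambda>x. x * y)" "hlinear (\<lambda>y. x * y)" for x y :: "('a, 'b) tensor"
proof -
  show l: "hlinear (\<lambda>x. x * y)" for y :: "('a, 'b) tensor"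
    unfolding times_tensor_def by (rule hlinear_tensor_lift[OF hbilinear_mult_aux])
  show "hlinear (\<lambda>y. x * y)"
  proof (induction x rule: tensor_induct)
    case (pure a b)
    have "pure a b * y = tensor_lift (\<lambda>c d. pure (a * c) (b * d)) y" for y
      by (simp add: times_tensor_def tensor_lift_pure[OF hbilinear_mult_aux])
    then show ?case by (simp add: hlinear_tensor_lift[OF hbilinear_pure_mult])
  next
    case (diff s t)
    have "(s - t) * y = s * y + (-1) *\<^sub>h (t * y)" for y
      using hlinear_diff[OF l, of s t y] by (simp add: hscale_one)
    with diff show ?case by (simp add: hlinear_plus hlinear_scaled del: hmod.scale_minus_left)
  qed
qed

instance
proof
  fix r and x y z :: "('a, 'b) tensor"
  note L = hlinear_mult_tensor(1) and R = hlinear_mult_tensor(2)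
  have 1: "pure a b * pure c d * z = pure a b * (pure c d * z)" for a b c d
    by (rule hlinear_tensor_eqI[where F = "\<lambda>z. pure a b * pure c d * z" and G = "\<lambda>z. pure a b * (pure c d * z)"])
      (simp_all add: R hlinear_compose[OF R R] pure_mult_pure mult.assoc)
  have 2: "pure a b * y * z = pure a b * (y * z)" for a b
    by (rule hlinear_tensor_eqI[where F = "\<lambda>y. pure a b * y * z" and G = "\<lambda>y. pure a b * (y * z)"])
      (simp_all add: hlinear_compose[OF R L] hlinear_compose[OF L R] 1)
  show "x * y * z = x * (y * z)"
    by (rule hlinear_tensor_eqI[where F = "\<lambda>x. x * y * z" and G = "\<lambda>x. x * (y * z)"])
      (simp_all add: L hlinear_compose[OF L L] 2)
  show "(x + y) * z = x * z + y * z" by (rule hlinear_add[OF L])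
  show "x * (y + z) = x * y + x * z" by (rule hlinear_add[OF R])
  show "(r *\<^sub>h x) * y = r *\<^sub>h (x * y)" by (rule hlinear_scale[OF L])
  show "x * (r *\<^sub>h y) = r *\<^sub>h (x * y)" by (rule hlinear_scale[OF R])
  show "1 * x = x"
    by (rule hlinear_tensor_eqI[where F = "\<lambda>x. 1 * x"]) (simp_all add: R hlinear_id one_tensor_def pure_mult_pure)
  show "x * 1 = x"
    by (rule hlinear_tensor_eqI[where F = "\<lambda>x. x * 1"]) (simp_all add: L hlinear_id one_tensor_def pure_mult_pure)
qed

end


section \<open>Completion in the \<open>h\<close>-adic topology\<close>

text \<open>
  \<open>lim M / h\<^sup>n M\<close>, a compatible family of residues being represented by lifts \<open>s n\<close> of its
  components.
\<close>

definition hcompatible :: "(nat \<Rightarrow> 'a::hmodule) \<Rightarrow> bool"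
  where "hcompatible s \<longleftrightarrow> (\<forall>n. s (Suc n) - s n \<in> hpow n)"

definition completion_rel :: "(nat \<Rightarrow> 'a::hmodule) \<Rightarrow> (nat \<Rightarrow> 'a) \<Rightarrow> bool"
  where "completion_rel s t \<longleftrightarrow> hcompatible s \<and> hcompatible t \<and> (\<forall>n. s n - t n \<in> hpow n)"

quotient_type (overloaded) 'a completion = "nat \<Rightarrow> 'a::hmodule" / partial: completion_rel
proof (rule part_equivpI)
  show "\<exists>s :: nat \<Rightarrow> 'a. completion_rel s s"
    by (rule exI[of _ "\<lambda>_. 0"]) (simp add: completion_rel_def hcompatible_def)
  show "symp (completion_rel :: (nat \<Rightarrow> 'a) \<Rightarrow> _)"
    by (auto simp: symp_def completion_rel_def hpow_diff_commute)
  show "transp (completion_rel :: (nat \<Rightarrow> 'a) \<Rightarrow> _)"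
    by (auto simp: transp_def completion_rel_def intro: hpow_diff_trans)
qed

lift_definition to_completion :: "'a::hmodule \<Rightarrow> 'a completion"
  is "\<lambda>x _. x"
  by (simp add: completion_rel_def hcompatible_def)

instantiation completion :: (hmodule) hmodule
begin

lift_definition zero_completion :: "'a completion"
  is "\<lambda>_. 0"
  by (simp add: completion_rel_def hcompatible_def)

lift_definition plus_completion :: "'a completion \<Rightarrow> 'a completion \<Rightarrow> 'a completion"
  is "\<lambda>s t n. s n + t n"
  by (simp add: completion_rel_def hcompatible_def hpow_cong_add)

lift_definition minus_completion :: "'a completion \<Rightarrow> 'a completion \<Rightarrow> 'a completion"
  is "\<lambda>s t n. s n - t n"
  by (simp add: completion_rel_def hcompatible_def hpow_cong_diff)

lift_definition uminus_completion :: "'a completion \<Rightarrow> 'a completion"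
  is "\<lambda>s n. - s n"
  unfolding completion_rel_def hcompatible_def by (blast intro: hpow_cong_minus)

lift_definition hscale_completion :: "complex fps \<Rightarrow> 'a completion \<Rightarrow> 'a completion"
  is "\<lambda>r s n. r *\<^sub>h s n"
  by (simp add: completion_rel_def hcompatible_def hpow_cong_scale)

instance
proof
  fix r s :: "complex fps" and x y z :: "'a completion"
  show "x + y + z = x + (y + z)"
    by transfer (simp add: completion_rel_def hcompatible_def hpow_cong_add add.assoc)
  show "x + y = y + x"
    by transfer (simp add: completion_rel_def hcompatible_def hpow_cong_add add.commute)
  show "0 + x = x"
    by transfer (simp add: completion_rel_def hcompatible_def)
  show "- x + x = 0"
    by transfer (simp add: completion_rel_def hcompatible_def)
  show "x - y = x + - y"
    by transfer (simp add: completion_rel_def hcompatible_def hpow_cong_diff)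
  show "r *\<^sub>h (x + y) = r *\<^sub>h x + r *\<^sub>h y"
    by transfer (simp add: completion_rel_def hcompatible_def hpow_cong_add hpow_cong_scale hscale_right_distrib)
  show "(r + s) *\<^sub>h x = r *\<^sub>h x + s *\<^sub>h x"
    by transfer (simp add: completion_rel_def hcompatible_def hpow_cong_add hpow_cong_scale hscale_left_distrib)
  show "r *\<^sub>h s *\<^sub>h x = (r * s) *\<^sub>h x"
    by transfer (simp add: completion_rel_def hcompatible_def hpow_cong_scale)
  show "1 *\<^sub>h x = x"
    by transfer (simp add: completion_rel_def hcompatible_def)
qed

end

instantiation completion :: (halgebra) halgebra
begin

lift_definition one_completion :: "'a completion"
  is "\<lambda>_. 1"
  by (simp add: completion_rel_def hcompatible_def)

lift_definition times_completion :: "'a completion \<Rightarrow> 'a completion \<Rightarrow> 'a completion"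
  is "\<lambda>s t n. s n * t n"
  by (simp add: completion_rel_def hcompatible_def hpow_cong_mult)

instance
proof
  fix r and x y z :: "'a completion"
  note [simp] = completion_rel_def hcompatible_def hpow_cong_add hpow_cong_mult hpow_cong_scale
  show "x * y * z = x * (y * z)" by transfer (simp add: mult.assoc)
  show "(x + y) * z = x * z + y * z" by transfer (simp add: distrib_right)
  show "x * (y + z) = x * y + x * z" by transfer (simp add: distrib_left)
  show "(r *\<^sub>h x) * y = r *\<^sub>h (x * y)" by transfer (simp add: hscale_mult_left)
  show "x * (r *\<^sub>h y) = r *\<^sub>h (x * y)" by transfer (simp add: hscale_mult_right)
  show "1 * x = x" by transfer simp
  show "x * 1 = x" by transfer simp
qed

end

lemma hcompatible_iff: "hcompatible s \<longleftrightarrow> completion_rel s s"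
  by (simp add: completion_rel_def)

lemma completion_cases:
  obtains s where "hcompatible s" "x = abs_completion s"
proof -
  have "completion_rel (rep_completion x) (rep_completion x)"
    by (rule Quotient3_rep_reflp[OF Quotient3_completion])
  then show ?thesis
    using that by (metis Quotient3_abs_rep Quotient3_completion completion_rel_def)
qed

lemma abs_completion_eq:
  "hcompatible s \<Longrightarrow> hcompatible t \<Longrightarrow> abs_completion s = abs_completion t \<longleftrightarrow> (\<forall>n. s n - t n \<in> hpow n)"
  using Quotient3_rel[OF Quotient3_completion, of s t] by (auto simp: completion_rel_def)

lemma hcompatible_mono: "hcompatible s \<Longrightarrow> m \<le> n \<Longrightarrow> s n - s m \<in> hpow m"
proof (induction n)
  case 0
  then show ?case by simp
next
  case (Suc n)
  show ?case
  proof (cases "m = Suc n")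
    case False
    with Suc have "m \<le> n" by simp
    moreover from this have "s (Suc n) - s n \<in> hpow m"
      using Suc.prems by (auto simp: hcompatible_def intro: hpow_mono)
    ultimately show ?thesis using Suc by (blast intro: hpow_diff_trans)
  qed simp
qed

lemma abs_completion_in_hpow:
  assumes s: "hcompatible s"
  shows "abs_completion s \<in> hpow n \<longleftrightarrow> s n \<in> hpow n"
proof
  assume "abs_completion s \<in> hpow n"
  then obtain y where y: "abs_completion s = fps_X ^ n *\<^sub>h y" by (auto simp: hpow_iff)
  obtain t where t: "hcompatible t" "y = abs_completion t" by (rule completion_cases)
  have "fps_X ^ n *\<^sub>h y = abs_completion (\<lambda>k. fps_X ^ n *\<^sub>h t k)"
    using t by (simp add: hscale_completion.abs_eq hcompatible_iff)
  then have "s n - fps_X ^ n *\<^sub>h t n \<in> hpow n"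
    using abs_completion_eq[OF s, of "\<lambda>k. fps_X ^ n *\<^sub>h t k"] t y
    by (auto simp: hcompatible_def hpow_cong_scale)
  then show "s n \<in> hpow n" using hpow_add[OF _ hpowI, of "s n - fps_X ^ n *\<^sub>h t n" n "t n"] by simp
next
  assume *: "s n \<in> hpow n"
  have "\<exists>y. s (Suc k) - s k = fps_X ^ k *\<^sub>h y" for k
    using s by (auto simp: hcompatible_def hpow_iff)
  then obtain d where d: "s (Suc k) - s k = fps_X ^ k *\<^sub>h d k" for k by metis
  from * obtain y where y: "s n = fps_X ^ n *\<^sub>h y" by (auto simp: hpow_iff)
  have sum: "s (n + k) = fps_X ^ n *\<^sub>h (y + (\<Sum>j<k. fps_X ^ j *\<^sub>h d (n + j)))" for k
  proof (induction k)
    case 0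
    then show ?case by (simp add: y)
  next
    case (Suc k)
    have "s (n + Suc k) = s (n + k) + fps_X ^ (n + k) *\<^sub>h d (n + k)"
      using d[of "n + k"] by (simp add: algebra_simps)
    then show ?case unfolding Suc
      by (simp add: hscale_right_distrib power_add add.assoc)
  qed
  define u where "u k = y + (\<Sum>j<k. fps_X ^ j *\<^sub>h d (n + j))" for k
  have u: "hcompatible u" by (simp add: hcompatible_def u_def hpowI)
  have "s k - fps_X ^ n *\<^sub>h u k \<in> hpow k" for k
    using hcompatible_mono[OF s, of k "n + k"] sum[of k] by (simp add: u_def hpow_diff_commute)
  then have "abs_completion s = abs_completion (\<lambda>k. fps_X ^ n *\<^sub>h u k)"
    using abs_completion_eq[OF s, of "\<lambda>k. fps_X ^ n *\<^sub>h u k"] u by (simp add: hcompatible_def hpow_cong_scale)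
  also have "\<dots> = fps_X ^ n *\<^sub>h abs_completion u"
    using u by (simp add: hscale_completion.abs_eq hcompatible_iff)
  finally show "abs_completion s \<in> hpow n" by (simp add: hpowI)
qed

lemma abs_completion_diff:
  "hcompatible s \<Longrightarrow> hcompatible t \<Longrightarrow> abs_completion s - abs_completion t = abs_completion (\<lambda>n. s n - t n)"
  by (simp add: minus_completion.abs_eq hcompatible_iff)

lemma hcompatible_diff: "hcompatible s \<Longrightarrow> hcompatible t \<Longrightarrow> hcompatible (\<lambda>n. s n - t n)"
  by (simp add: hcompatible_def hpow_cong_diff)

instance completion :: (hmodule) hadic_module
proof
  fix x :: "'a completion"
  assume *: "x \<in> hpow n" for n
  obtain s where s: "hcompatible s" "x = abs_completion s" by (rule completion_cases)
  have "abs_completion s = abs_completion (\<lambda>_. 0)"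
    using * s abs_completion_eq[OF s(1), of "\<lambda>_. 0"] by (simp add: abs_completion_in_hpow hcompatible_def)
  then show "x = 0" using s by (simp add: zero_completion_def)
next
  fix x :: "nat \<Rightarrow> 'a completion"
  assume *: "x (Suc n) - x n \<in> hpow n" for n
  have "\<exists>s. hcompatible s \<and> x n = abs_completion s" for n
    by (rule completion_cases) blast
  then obtain s where s: "hcompatible (s n)" "x n = abs_completion (s n)" for n by metis
  have step: "s (Suc n) n - s n n \<in> hpow n" for n
    using * [of n] s
    by (simp add: abs_completion_diff abs_completion_in_hpow hcompatible_diff)
  define l where "l n = s n n" for n
  have l: "hcompatible l"
    unfolding hcompatible_def l_def
  proof
    fix n
    have "s (Suc n) (Suc n) - s (Suc n) n \<in> hpow n"
      using s(1)[of "Suc n"] by (simp add: hcompatible_def)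
    with step[of n] show "s (Suc n) (Suc n) - s n n \<in> hpow n" by (blast intro: hpow_diff_trans)
  qed
  have "abs_completion l - x n \<in> hpow n" for n
    by (simp add: s(2) abs_completion_diff[OF l s(1)] abs_completion_in_hpow[OF hcompatible_diff[OF l s(1)]])
      (simp add: l_def)
  then show "\<exists>l. \<forall>n. l - x n \<in> hpow n" by blast
qed

instance completion :: (halgebra) hadic_algebra ..

lemma completion_dense: "\<exists>y. x - to_completion y \<in> hpow n"
proof -
  obtain s where s: "hcompatible s" "x = abs_completion s" by (rule completion_cases)
  have const: "hcompatible (\<lambda>_. s n)" by (simp add: hcompatible_def)
  have "x - to_completion (s n) \<in> hpow n"
    by (simp add: s to_completion.abs_eq abs_completion_diff const abs_completion_in_hpow hcompatible_diff)
  then show ?thesis by blast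
qed

lemma hlinear_completion_eqI:
  fixes F G :: "'a::hmodule completion \<Rightarrow> 'b::hadic_module"
  assumes "hlinear F" "hlinear G" "\<And>y. F (to_completion y) = G (to_completion y)"
  shows "F x = G x"
proof (rule hadic_eqI)
  fix n
  obtain y where y: "x - to_completion y \<in> hpow n" using completion_dense by blast
  have "F x - G x = F (x - to_completion y) - G (x - to_completion y)"
    using assms by (simp add: hlinear_diff)
  then show "F x - G x \<in> hpow n"
    using hlinear_hpow[OF assms(1) y] hlinear_hpow[OF assms(2) y] by (simp add: hpow_diff)
qed

lemma hlinear_to_completion: "hlinear to_completion"
proof -
  have "to_completion (x + y) = to_completion x + to_completion y"
    "to_completion (r *\<^sub>h x) = r *\<^sub>h to_completion x" for x y :: 'a and r
    by (transfer; simp add: completion_rel_def hcompatible_def)+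
  then show ?thesis by (simp add: hlinear_iff)
qed

lemma to_completion_mult: "to_completion (x * y) = to_completion x * to_completion y"
  by transfer (simp add: completion_rel_def hcompatible_def)

lemma to_completion_one: "to_completion 1 = 1"
  by transfer (simp add: completion_rel_def hcompatible_def)

lemma completion_extend_exists:
  fixes f :: "'a::hmodule \<Rightarrow> 'b::hadic_module"
  assumes f: "hlinear f"
  shows "\<exists>F. hlinear F \<and> (\<forall>y. F (to_completion y) = f y)"
proof -
  have "\<exists>l. \<forall>s. hcompatible s \<longrightarrow> x = abs_completion s \<longrightarrow> (\<forall>n. l - f (s n) \<in> hpow n)" for x
  proof -
    obtain s where s: "hcompatible s" "x = abs_completion s" by (rule completion_cases)
    have "f (s (Suc n)) - f (s n) \<in> hpow n" for n
      using s hlinear_hpow[OF f, of "s (Suc n) - s n"] by (simp add: hcompatible_def hlinear_diff[OF f])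
    then obtain l where l: "l - f (s n) \<in> hpow n" for n
      using hadic_complete[of "\<lambda>n. f (s n)"] by blast
    have "l - f (t n) \<in> hpow n" if "hcompatible t" "x = abs_completion t" for t n
    proof -
      have "s n - t n \<in> hpow n" using abs_completion_eq[OF s(1) that(1)] s(2) that(2) by auto
      then have "f (s n) - f (t n) \<in> hpow n"
        using hlinear_hpow[OF f] by (simp flip: hlinear_diff[OF f])
      then show ?thesis by (rule hpow_diff_trans[OF l])
    qed
    then show ?thesis by blast
  qed
  then obtain F where F: "hcompatible s \<Longrightarrow> F (abs_completion s) - f (s n) \<in> hpow n" for s n
    by metis
  have "F (x + y) = F x + F y" for x y
  proof -
    obtain s t where s: "hcompatible s" "x = abs_completion s"
      and t: "hcompatible t" "y = abs_completion t" by (meson completion_cases)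
    have st: "hcompatible (\<lambda>n. s n + t n)" using s t by (simp add: hcompatible_def hpow_cong_add)
    have xy: "x + y = abs_completion (\<lambda>n. s n + t n)"
      using s t by (simp add: plus_completion.abs_eq hcompatible_iff)
    show ?thesis
    proof (rule hadic_eqI)
      fix n
      have "F (x + y) - (f (s n) + f (t n)) \<in> hpow n"
        using F[OF st, of n] by (simp add: xy hlinear_add[OF f])
      moreover have "f (s n) + f (t n) - (F x + F y) \<in> hpow n"
        using F[OF s(1), of n] F[OF t(1), of n] hpow_diff_commute s(2) t(2)
        by (intro hpow_cong_add) blast+
      ultimately show "F (x + y) - (F x + F y) \<in> hpow n" by (rule hpow_diff_trans)
    qed
  qed
  moreover have "F (r *\<^sub>h x) = r *\<^sub>h F x" for r x
  proof -
    obtain s where s: "hcompatible s" "x = abs_completion s" by (rule completion_cases)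
    have rs: "hcompatible (\<lambda>n. r *\<^sub>h s n)" using s by (simp add: hcompatible_def hpow_cong_scale)
    have rx: "r *\<^sub>h x = abs_completion (\<lambda>n. r *\<^sub>h s n)"
      using s by (simp add: hscale_completion.abs_eq hcompatible_iff)
    show ?thesis
    proof (rule hadic_eqI)
      fix n
      have "F (r *\<^sub>h x) - r *\<^sub>h f (s n) \<in> hpow n"
        using F[OF rs, of n] by (simp add: rx hlinear_scale[OF f])
      moreover have "r *\<^sub>h f (s n) - r *\<^sub>h F x \<in> hpow n"
        using F[OF s(1), of n] hpow_diff_commute s(2) by (intro hpow_cong_scale) blast
      ultimately show "F (r *\<^sub>h x) - r *\<^sub>h F x \<in> hpow n" by (rule hpow_diff_trans)
    qed
  qed
  moreover have "F (to_completion y) = f y" for y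
  proof (rule hadic_eqI)
    show "F (to_completion y) - f y \<in> hpow n" for n
      using F[of "\<lambda>_. y" n] by (simp add: to_completion.abs_eq hcompatible_def)
  qed
  ultimately show ?thesis by (auto simp: hlinear_iff)
qed


section \<open>Completed tensor products\<close>

type_synonym ('a, 'b) ctensor = "('a, 'b) tensor completion"

definition cpure :: "'a::hmodule \<Rightarrow> 'b::hmodule \<Rightarrow> ('a, 'b) ctensor"  (infix \<open>\<otimes>\<^sub>h\<close> 75)
  where "a \<otimes>\<^sub>h b = to_completion (pure a b)"

text \<open>
  The linear map on the completed tensor product induced by a bilinear map into a complete
  module; linear maps are automatically \<open>h\<close>-adically continuous.
\<close>

definition ctensor_lift ::
    "('a::hmodule \<Rightarrow> 'b::hmodule \<Rightarrow> 'c::hadic_module) \<Rightarrow> ('a, 'b) ctensor \<Rightarrow> 'c"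
  where "ctensor_lift \<beta> = (THE F. hlinear F \<and> (\<forall>a b. F (a \<otimes>\<^sub>h b) = \<beta> a b))"

lemma hlinear_ctensor_eqI:
  fixes F G :: "('a::hmodule, 'b::hmodule) ctensor \<Rightarrow> 'c::hadic_module"
  assumes F: "hlinear F" and G: "hlinear G" and eq: "\<And>a b. F (a \<otimes>\<^sub>h b) = G (a \<otimes>\<^sub>h b)"
  shows "F t = G t"
proof (rule hlinear_completion_eqI[OF F G])
  show "F (to_completion t) = G (to_completion t)" for t
    by (rule hlinear_tensor_eqI[OF hlinear_compose[OF hlinear_to_completion F]
          hlinear_compose[OF hlinear_to_completion G]])
      (use eq in \<open>simp add: cpure_def\<close>)
qed

lemma ctensor_lift:
  assumes "hbilinear \<beta>"
  shows hlinear_ctensor_lift: "hlinear (ctensor_lift \<beta>)"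
    and ctensor_lift_pure: "ctensor_lift \<beta> (a \<otimes>\<^sub>h b) = \<beta> a b"
proof -
  have "\<exists>!F. hlinear F \<and> (\<forall>a b. F (a \<otimes>\<^sub>h b) = \<beta> a b)"
  proof (rule ex_ex1I)
    show "\<exists>F. hlinear F \<and> (\<forall>a b. F (a \<otimes>\<^sub>h b) = \<beta> a b)"
      using completion_extend_exists[OF hlinear_tensor_lift[OF assms]]
      by (auto simp: cpure_def tensor_lift_pure[OF assms])
    show "F = G" if "hlinear F \<and> (\<forall>a b. F (a \<otimes>\<^sub>h b) = \<beta> a b)"
      "hlinear G \<and> (\<forall>a b. G (a \<otimes>\<^sub>h b) = \<beta> a b)" for F G
      using that by - (rule ext, rule hlinear_ctensor_eqI, simp_all)
  qed
  from theI'[OF this] show "hlinear (ctensor_lift \<beta>)" "ctensor_lift \<beta> (a \<otimes>\<^sub>h b) = \<beta> a b"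
    by (auto simp: ctensor_lift_def)
qed

lemma cpure_mult_cpure: "(a \<otimes>\<^sub>h b) * (c \<otimes>\<^sub>h d) = (a * c) \<otimes>\<^sub>h (b * d)"
  by (simp add: cpure_def pure_mult_pure flip: to_completion_mult)

lemma cpure_one: "1 \<otimes>\<^sub>h 1 = 1"
  by (simp add: cpure_def to_completion_one flip: one_tensor_def)

lemma hbilinear_cpure: "hbilinear (\<otimes>\<^sub>h)"
  by (rule hbilinearI)
    (simp_all add: cpure_def pure_add_left pure_add_right pure_scale_left pure_scale_right
      hlinear_add[OF hlinear_to_completion] hlinear_scale[OF hlinear_to_completion])

definition ctensor_map :: "('a::hmodule \<Rightarrow> 'c::hmodule) \<Rightarrow> ('b::hmodule \<Rightarrow> 'd::hmodule)
    \<Rightarrow> ('a, 'b) ctensor \<Rightarrow> ('c, 'd) ctensor"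
  where "ctensor_map f g = ctensor_lift (\<lambda>a b. f a \<otimes>\<^sub>h g b)"

lemma ctensor_map:
  assumes "hlinear f" "hlinear g"
  shows hlinear_ctensor_map: "hlinear (ctensor_map f g)"
    and ctensor_map_pure: "ctensor_map f g (a \<otimes>\<^sub>h b) = f a \<otimes>\<^sub>h g b"
proof -
  have "hbilinear (\<lambda>a b. f a \<otimes>\<^sub>h g b)"
    using assms by (intro hbilinearI) (simp_all add: hlinear_add hlinear_scale hbilinear_simps[OF hbilinear_cpure])
  from ctensor_lift[OF this] show "hlinear (ctensor_map f g)" "ctensor_map f g (a \<otimes>\<^sub>h b) = f a \<otimes>\<^sub>h g b"
    by (simp_all add: ctensor_map_def)
qed

text \<open>The canonical identifications of iterated tensor products.\<close>

definition ctensor_assoc :: "('a::hmodule, ('b::hmodule, 'c::hmodule) ctensor) ctensor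
    \<Rightarrow> (('a, 'b) ctensor, 'c) ctensor"
  where "ctensor_assoc = ctensor_lift (\<lambda>a. ctensor_lift (\<lambda>b c. (a \<otimes>\<^sub>h b) \<otimes>\<^sub>h c))"

definition ctensor_left_unit :: "(complex fps, 'a::hadic_module) ctensor \<Rightarrow> 'a"
  where "ctensor_left_unit = ctensor_lift (\<lambda>r a. r *\<^sub>h a)"

definition ctensor_right_unit :: "('a::hadic_module, complex fps) ctensor \<Rightarrow> 'a"
  where "ctensor_right_unit = ctensor_lift (\<lambda>a r. r *\<^sub>h a)"

definition ctensor_mult :: "('a::hadic_algebra, 'a) ctensor \<Rightarrow> 'a"
  where "ctensor_mult = ctensor_lift (*)"


section \<open>Hopf algebras, Hopf duals and right comodule algebras\<close>

locale hopf_algebra =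
  fixes comult :: "'a::hadic_algebra \<Rightarrow> ('a, 'a) ctensor"
    and counit :: "'a \<Rightarrow> complex fps"
    and antipode :: "'a \<Rightarrow> 'a"
  assumes comult_hom: "halg_hom comult"
    and counit_hom: "halg_hom counit"
    and antipode_linear: "hlinear antipode"
    and coassoc: "ctensor_assoc (ctensor_map id comult (comult x)) = ctensor_map comult id (comult x)"
    and counit_left: "ctensor_left_unit (ctensor_map counit id (comult x)) = x"
    and counit_right: "ctensor_right_unit (ctensor_map id counit (comult x)) = x"
    and antipode_left: "ctensor_mult (ctensor_map antipode id (comult x)) = counit x *\<^sub>h 1"
    and antipode_right: "ctensor_mult (ctensor_map id antipode (comult x)) = counit x *\<^sub>h 1"

text \<open>
  A Hopf dual of \<open>\<H>\<close> is a Hopf algebra of linear functionals on \<open>\<H>\<close> whose operations are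
  the transposes of those of \<open>\<H>\<close>; \<open>pairing f x\<close> is the value of the functional \<open>f\<close> at \<open>x\<close>.
  How large a space of functionals is taken (for instance the \<open>h\<close>-adic completion of the span of
  the matrix coefficients of some class of representations) is left open.
\<close>

locale hopf_dual =
  H: hopf_algebra comult_H counit_H antipode_H + dual: hopf_algebra comult counit antipode
  for comult_H :: "'h::hadic_algebra \<Rightarrow> ('h, 'h) ctensor"
    and counit_H :: "'h \<Rightarrow> complex fps"
    and antipode_H :: "'h \<Rightarrow> 'h"
    and comult :: "'d::hadic_algebra \<Rightarrow> ('d, 'd) ctensor"
    and counit :: "'d \<Rightarrow> complex fps"
    and antipode :: "'d \<Rightarrow> 'd" +
  fixes pairing :: "'d \<Rightarrow> 'h \<Rightarrow> complex fps"
  assumes pairing_bilinear: "hbilinear pairing"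
    and pairing_faithful: "(\<And>x. pairing f x = pairing g x) \<Longrightarrow> f = g"
    and pairing_mult: "pairing (f * g) x = ctensor_mult (ctensor_map (pairing f) (pairing g) (comult_H x))"
    and pairing_one: "pairing 1 x = counit_H x"
    and pairing_comult:
      "ctensor_mult (ctensor_map (\<lambda>f. pairing f x) (\<lambda>f. pairing f y) (comult f)) = pairing f (x * y)"
    and pairing_counit: "counit f = pairing f 1"
    and pairing_antipode: "pairing (antipode f) x = pairing f (antipode_H x)"

locale right_comodule_algebra = dual: hopf_algebra comult counit antipode
  for comult :: "'d::hadic_algebra \<Rightarrow> ('d, 'd) ctensor"
    and counit :: "'d \<Rightarrow> complex fps"
    and antipode :: "'d \<Rightarrow> 'd" +
  fixes coact :: "'a::hadic_algebra \<Rightarrow> ('a, 'd) ctensor"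
  assumes coact_hom: "halg_hom coact"
    and coact_coassoc: "ctensor_assoc (ctensor_map id comult (coact a)) = ctensor_map coact id (coact a)"
    and coact_one: "coact 1 = 1 \<otimes>\<^sub>h 1"
    and coact_counit: "ctensor_right_unit (ctensor_map id counit (coact a)) = a"

definition character :: "('a::hadic_algebra \<Rightarrow> complex fps) \<Rightarrow> bool"
  where "character \<chi> \<longleftrightarrow> halg_hom \<chi>"

definition character_map ::
    "('a::hadic_algebra \<Rightarrow> ('a, 'd::hadic_algebra) ctensor) \<Rightarrow> ('a \<Rightarrow> complex fps) \<Rightarrow> 'a \<Rightarrow> 'd"
  where "character_map coact \<chi> = ctensor_left_unit \<circ> ctensor_map \<chi> id \<circ> coact"

end

theory Submission
  imports Defs
begin

text \<open>
  A map \<open>\<phi>\<close> recovers its character as \<open>\<epsilon> \<circ> \<phi>\<close>: applying \<open>\<epsilon> \<otimes> id\<close> to the equivariance condition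
  and using the counit axiom of \<open>\<H>\<^sup>*\<close> gives \<open>(\<epsilon> \<circ> \<phi> \<otimes> id) \<circ> \<delta> = \<phi>\<close>. Conversely, for a character
  \<open>\<chi>\<close>, coassociativity of the coaction rewrites \<open>(\<phi>\<^sub>\<chi> \<otimes> id) \<circ> \<delta>\<close> as \<open>(\<chi> \<otimes> id \<otimes> id) \<circ> (id \<otimes> \<Delta>) \<circ> \<delta>\<close>,
  and \<open>\<chi> \<otimes> id\<close> can be moved past \<open>\<Delta>\<close>. That all maps involved are algebra homomorphisms is
  checked on elementary tensors; for \<open>\<complex>[[h]] \<otimes> \<H>\<^sup>* \<simeq> \<H>\<^sup>*\<close> this uses that \<open>\<complex>[[h]]\<close> is commutative.
\<close>

lemma hlinear_mult_left: "hlinear (\<lambda>x. x * y)" and hlinear_mult_right: "hlinear (\<lambda>y. x * y)"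
  for x y :: "'a::halgebra"
  by (simp_all add: hlinear_iff distrib_left distrib_right hscale_mult_left hscale_mult_right)

lemma halg_homD:
  assumes "halg_hom f"
  shows "hlinear f" "f (x * y) = f x * f y" "f 1 = 1"
  using assms by (auto simp: halg_hom_def)

lemma halg_hom_comp: "halg_hom f \<Longrightarrow> halg_hom g \<Longrightarrow> halg_hom (g \<circ> f)"
  by (simp add: halg_hom_def hlinear_iff)

lemma halg_hom_id: "halg_hom id"
  by (simp add: halg_hom_def hlinear_iff)

text \<open>Both sides of the multiplicativity law are linear in each factor, and linear maps into
  an h-adically separated module agree as soon as they agree on elementary tensors. The factors are
  treated in turn: first \<open>y\<close> with \<open>a \<otimes>\<^sub>h b\<close> fixed, then
  \<open>x\<close>.\<close>

lemma halg_hom_ctensorI: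
  fixes F :: "('a::halgebra, 'b::halgebra) ctensor \<Rightarrow> 'c::hadic_algebra"
  assumes F: "hlinear F" and one: "F (1 \<otimes>\<^sub>h 1) = 1"
    and mult: "\<And>a b c d. F ((a * c) \<otimes>\<^sub>h (b * d)) = F (a \<otimes>\<^sub>h b) * F (c \<otimes>\<^sub>h d)"
  shows "halg_hom F"
proof -
  have pure: "F ((a \<otimes>\<^sub>h b) * y) = F (a \<otimes>\<^sub>h b) * F y" for a b y
    by (rule hlinear_ctensor_eqI[where F = "\<lambda>y. F ((a \<otimes>\<^sub>h b) * y)" and G = "\<lambda>y. F (a \<otimes>\<^sub>h b) * F y"])
      (simp_all add: hlinear_compose[OF hlinear_mult_right F] hlinear_compose[OF F hlinear_mult_right]
        cpure_mult_cpure mult)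
  have "F (x * y) = F x * F y" for x y
    by (rule hlinear_ctensor_eqI[where F = "\<lambda>x. F (x * y)" and G = "\<lambda>x. F x * F y"])
      (simp_all add: hlinear_compose[OF hlinear_mult_left F] hlinear_compose[OF F hlinear_mult_left] pure)
  with F one show ?thesis by (simp add: halg_hom_def cpure_one)
qed

lemma halg_hom_ctensor_map:
  assumes f: "halg_hom f" and g: "halg_hom g"
  shows "halg_hom (ctensor_map f g)"
proof -
  note lin = halg_homD(1)[OF f] halg_homD(1)[OF g]
  have "ctensor_map f g (1 \<otimes>\<^sub>h 1) = 1"
    unfolding ctensor_map_pure[OF lin] by (simp add: halg_homD(3)[OF f] halg_homD(3)[OF g] cpure_one)
  then show ?thesis
    by (rule halg_hom_ctensorI[OF hlinear_ctensor_map[OF lin]])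
      (simp add: ctensor_map_pure[OF lin] halg_homD(2)[OF f] halg_homD(2)[OF g] cpure_mult_cpure)
qed

lemma ctensor_map_comp:
  assumes "hlinear f" "hlinear f'" "hlinear g" "hlinear g'"
  shows "ctensor_map (f' \<circ> f) (g' \<circ> g) t = ctensor_map f' g' (ctensor_map f g t)"
proof -
  have lin: "hlinear (f' \<circ> f)" "hlinear (g' \<circ> g)"
    using assms by (simp_all add: hlinear_iff)
  show ?thesis
    by (rule hlinear_ctensor_eqI[OF hlinear_ctensor_map[OF lin]
          hlinear_compose[OF hlinear_ctensor_map[OF assms(1,3)] hlinear_ctensor_map[OF assms(2,4)]]])
      (simp only: ctensor_map_pure[OF lin] ctensor_map_pure[OF assms(1,3)] ctensor_map_pure[OF assms(2,4)] o_apply)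
qed

text \<open>By \<open>hscale_fps\<close> the action of \<open>complex fps\<close> on itself is
  multiplication, so linearity in \<open>r\<close> is associativity of the action; linearity in
  \<open>a\<close> rests on commutativity.\<close>

lemma hbilinear_hscale: "hbilinear (\<lambda>(r :: complex fps) (a :: 'a::hmodule). r *\<^sub>h a)"
  by (rule hbilinearI)
    (simp_all add: hscale_left_distrib hscale_right_distrib hscale_hscale hscale_fps mult.commute)

lemmas hlinear_ctensor_left_unit = hlinear_ctensor_lift[OF hbilinear_hscale, folded ctensor_left_unit_def]
lemmas ctensor_left_unit_pure = ctensor_lift_pure[OF hbilinear_hscale, folded ctensor_left_unit_def]

lemma halg_hom_ctensor_left_unit: "halg_hom (ctensor_left_unit :: (complex fps, 'a::hadic_algebra) ctensor \<Rightarrow> 'a)"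
  by (rule halg_hom_ctensorI)
    (simp_all add: hlinear_ctensor_left_unit ctensor_left_unit_pure hscale_one hscale_mult_left
      hscale_mult_right hscale_hscale mult.commute)

lemma hbilinear_cpure_cpure: "hbilinear (\<lambda>b c. (a \<otimes>\<^sub>h b) \<otimes>\<^sub>h c)"
  by (rule hbilinearI) (simp_all add: hbilinear_simps[OF hbilinear_cpure])

text \<open>\<open>ctensor_lift\<close> is a definite description, characterised only for bilinear
  arguments, so the outer of the two nested lifts in \<open>ctensor_assoc\<close> has to be
  justified. Linearity in \<open>a\<close> is tested on elementary tensors
  \<open>b \<otimes>\<^sub>h c\<close>.\<close>

lemma hbilinear_ctensor_assoc:
  "hbilinear (\<lambda>(a :: 'a::hmodule). ctensor_lift (\<lambda>(b :: 'b::hmodule) (c :: 'c::hmodule). (a \<otimes>\<^sub>h b) \<otimes>\<^sub>h c))"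
proof -
  define L where "L a = ctensor_lift (\<lambda>(b :: 'b) (c :: 'c). (a \<otimes>\<^sub>h b) \<otimes>\<^sub>h c)" for a :: 'a
  have lin: "hlinear (L a)" and L_pure: "L a (b \<otimes>\<^sub>h c) = (a \<otimes>\<^sub>h b) \<otimes>\<^sub>h c" for a b c
    unfolding L_def by (simp_all add: ctensor_lift[OF hbilinear_cpure_cpure])
  have "hbilinear L"
  proof (rule hbilinearI)
    show "L (a + a') t = L a t + L a' t" for a a' t
      by (rule hlinear_ctensor_eqI[OF lin hlinear_plus[OF lin lin]])
        (simp add: L_pure hbilinear_simps[OF hbilinear_cpure])
    show "L (r *\<^sub>h a) t = r *\<^sub>h L a t" for r a t
      by (rule hlinear_ctensor_eqI[OF lin hlinear_scaled[OF lin]])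
        (simp add: L_pure hbilinear_simps[OF hbilinear_cpure])
  qed (simp_all add: hlinear_add[OF lin] hlinear_scale[OF lin])
  then show ?thesis by (simp add: L_def[abs_def])
qed

lemma hlinear_ctensor_assoc: "hlinear ctensor_assoc"
  unfolding ctensor_assoc_def by (rule hlinear_ctensor_lift[OF hbilinear_ctensor_assoc])

lemma ctensor_assoc_pure: "ctensor_assoc (a \<otimes>\<^sub>h (b \<otimes>\<^sub>h c)) = (a \<otimes>\<^sub>h b) \<otimes>\<^sub>h c"
  by (simp add: ctensor_assoc_def ctensor_lift_pure[OF hbilinear_ctensor_assoc]
      ctensor_lift_pure[OF hbilinear_cpure_cpure])

text \<open>For \<open>t = b \<otimes>\<^sub>h c\<close> the left side is
  \<open>(\<chi> a *\<^sub>h b) \<otimes>\<^sub>h c\<close>, and the scalar can be pulled out;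
  linearity in \<open>t\<close> does the rest. A general \<open>t\<close> is wanted because the
  lemma will be applied to coproducts \<open>comult b\<close>, which need not be elementary.\<close>

lemma ctensor_map_left_unit_assoc:
  fixes \<chi> :: "'a::hmodule \<Rightarrow> complex fps" and t :: "('b::hadic_module, 'c::hadic_module) ctensor"
  assumes \<chi>: "hlinear \<chi>"
  shows "ctensor_map (ctensor_left_unit \<circ> ctensor_map \<chi> id) id (ctensor_assoc (a \<otimes>\<^sub>h t)) = \<chi> a *\<^sub>h t"
proof -
  have id: "hlinear id" by (simp add: hlinear_iff)
  have lin: "hlinear (ctensor_left_unit \<circ> ctensor_map \<chi> (id :: 'b \<Rightarrow> 'b))"
    using hlinear_compose[OF hlinear_ctensor_map[OF \<chi> id] hlinear_ctensor_left_unit] by (simp add: comp_def)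
  have a: "hlinear (\<lambda>t :: ('b, 'c) ctensor. a \<otimes>\<^sub>h t)"
    by (simp add: hlinear_iff hbilinear_simps[OF hbilinear_cpure])
  show ?thesis
    by (rule hlinear_ctensor_eqI[where t = t and G = "\<lambda>t. \<chi> a *\<^sub>h t",
          OF hlinear_compose[OF hlinear_compose[OF a hlinear_ctensor_assoc] hlinear_ctensor_map[OF lin id]]
            hlinear_scaled[OF hlinear_id]])
      (simp add: ctensor_assoc_pure ctensor_map_pure[OF lin id] ctensor_map_pure[OF \<chi> id]
        ctensor_left_unit_pure hbilinear_simps[OF hbilinear_cpure])
qed

context right_comodule_algebra
begin

lemma halg_hom_character_map: "character \<chi> \<Longrightarrow> halg_hom (character_map coact \<chi>)"
  unfolding character_def character_map_def
  by (intro halg_hom_comp coact_hom halg_hom_ctensor_left_unit halg_hom_ctensor_map halg_hom_id)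

lemma character_map_equivariant:
  assumes "character \<chi>"
  shows "ctensor_map (character_map coact \<chi>) id \<circ> coact = comult \<circ> character_map coact \<chi>"
proof
  fix x
  have \<chi>: "hlinear \<chi>" using assms by (simp add: character_def halg_hom_def)
  have id: "hlinear id" by (simp add: hlinear_iff)
  have \<Delta>: "hlinear comult" by (rule halg_homD(1)[OF dual.comult_hom])
  define L where "L = (ctensor_left_unit \<circ> ctensor_map \<chi> id :: ('a, 'd) ctensor \<Rightarrow> 'd)"
  have L: "hlinear L"
    using hlinear_compose[OF hlinear_ctensor_map[OF \<chi> id] hlinear_ctensor_left_unit]
    by (simp add: L_def comp_def)
  \<comment> \<open>Since \<open>character_map coact \<chi>\<close> is
    \<open>L \<circ> coact\<close>, functoriality splits off the iterated coaction, to which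
    coassociativity applies.\<close>
  have "(ctensor_map (character_map coact \<chi>) id \<circ> coact) x = ctensor_map L id (ctensor_map coact id (coact x))"
    using ctensor_map_comp[OF halg_homD(1)[OF coact_hom] L id id, of "coact x"]
    by (simp add: L_def character_map_def)
  also have "\<dots> = ctensor_map L id (ctensor_assoc (ctensor_map id comult (coact x)))"
    by (simp add: coact_coassoc)
  \<comment> \<open>Both sides are linear in \<open>coact x\<close>, which may therefore be replaced
    by any \<open>a \<otimes>\<^sub>h b\<close>; each side then equals
    \<open>\<chi> a *\<^sub>h comult b\<close>.\<close>
  also have "\<dots> = comult (L (coact x))"
    by (rule hlinear_ctensor_eqI[where t = "coact x",
          OF hlinear_compose[OF hlinear_compose[OF hlinear_ctensor_map[OF id \<Delta>] hlinear_ctensor_assoc]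
            hlinear_ctensor_map[OF L id]] hlinear_compose[OF L \<Delta>]])
      (simp add: L_def ctensor_map_pure[OF id \<Delta>] ctensor_map_left_unit_assoc[OF \<chi>]
        ctensor_map_pure[OF \<chi> id] ctensor_left_unit_pure hlinear_scale[OF \<Delta>])
  finally show "(ctensor_map (character_map coact \<chi>) id \<circ> coact) x = (comult \<circ> character_map coact \<chi>) x"
    by (simp add: L_def character_map_def)
qed

lemma equivariant_eq_character_map:
  assumes \<phi>: "halg_hom \<phi>" and eq: "ctensor_map \<phi> id \<circ> coact = comult \<circ> \<phi>"
  shows "\<phi> = character_map coact (counit \<circ> \<phi>)"
proof
  fix x
  have id: "hlinear id" by (simp add: hlinear_iff)
  \<comment> \<open>Functoriality moves \<open>\<phi>\<close> innermost, where equivariance turns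
    the inner term into \<open>comult (\<phi> x)\<close>.\<close>
  have "character_map coact (counit \<circ> \<phi>) x
      = ctensor_left_unit (ctensor_map counit id (ctensor_map \<phi> id (coact x)))"
    using ctensor_map_comp[OF halg_homD(1)[OF \<phi>] halg_homD(1)[OF dual.counit_hom] id id, of "coact x"]
    by (simp add: character_map_def)
  also have "\<dots> = ctensor_left_unit (ctensor_map counit id (comult (\<phi> x)))"
    using fun_cong[OF eq, of x] by simp
  also have "\<dots> = \<phi> x" by (rule dual.counit_left)
  finally show "\<phi> x = character_map coact (counit \<circ> \<phi>) x" by simp
qed

end

theorem proposition3p2:
  fixes comult_H :: "'h::hadic_algebra \<Rightarrow> ('h, 'h) ctensor"
    and counit_H :: "'h \<Rightarrow> complex fps"
    and antipode_H :: "'h \<Rightarrow> 'h"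
    and comult :: "'d::hadic_algebra \<Rightarrow> ('d, 'd) ctensor"
    and counit :: "'d \<Rightarrow> complex fps"
    and antipode :: "'d \<Rightarrow> 'd"
    and pairing :: "'d \<Rightarrow> 'h \<Rightarrow> complex fps"
    and coact :: "'a::hadic_algebra \<Rightarrow> ('a, 'd) ctensor"
  assumes "hopf_dual comult_H counit_H antipode_H comult counit antipode pairing"
    and "right_comodule_algebra comult counit antipode coact"
  shows "(\<forall>\<chi>. character \<chi> \<longrightarrow>
            halg_hom (character_map coact \<chi>) \<and>
            ctensor_map (character_map coact \<chi>) id \<circ> coact = comult \<circ> character_map coact \<chi>) \<and>
         (\<forall>\<phi>. halg_hom \<phi> \<and> ctensor_map \<phi> id \<circ> coact = comult \<circ> \<phi> \<longrightarrow>
            (\<exists>\<chi>. character \<chi> \<and> \<phi> = character_map coact \<chi>))"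
proof -
  interpret right_comodule_algebra comult counit antipode coact by (rule assms(2))
  have "character (counit \<circ> \<phi>)" if "halg_hom \<phi>" for \<phi> :: "'a \<Rightarrow> 'd"
    unfolding character_def by (rule halg_hom_comp[OF that dual.counit_hom])
  then show ?thesis
    using halg_hom_character_map character_map_equivariant equivariant_eq_character_map by blast
qed

end
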